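(* Let $V$ be an associative double algebra over a field $\Bbbk$ with double bracket $\{\!\{\cdot,\cdot\}\!\}$. Then the same space $V$ equipped with the double bracket $$[\![a,b]\!]=\{\!\{a,b\}\!\}-\{\!\{b,a\}\!\}^{(12)},\quad a,b\in V,$$ is a Lie double algebra.
   Context: A double algebra over a field $\Bbbk$ is a linear space $V$ with a linear map (double bracket) $V\otimes V\to V\otimes V$, $a\otimes b\mapsto \{\!\{a,b\}\!\}$. For $u\in V^{\otimes n}$ and $\sigma\in S_n$, $u^\sigma$ denotes the result of permuting the tensor factors of $u$ by $\sigma$ (e.g. $u^{(12)}$ interchanges the first two factors). A double bracket is extended linearly to four maps $V^{\otimes 3}\to V^{\otimes 3}$ by $\{\!\{a,b\otimes c\}\!\}_L=\{\!\{a,b\}\!\}\otimes c$, $\{\!\{a,b\otimes c\}\!\}_R=(b\otimes\{\!\{a,c\}\!\})^{(12)}$, $\{\!\{a\otimes b,c\}\!\}_L=(\{\!\{a,c\}\!\}\otimes b)^{(23)}$, $\{\!\{a\otimes b,c\}\!\}_R=a\otimes\{\!\{b,c\}\!\}$. A double algebra is associative if for all $a,b,c$: $\{\!\{a,\{\!\{b,c\}\!\}\}\!\}_L=\{\!\{\{\!\{a,b\}\!\},c\}\!\}_L$ and $\{\!\{a,\{\!\{b,c\}\!\}\}\!\}_R=\{\!\{\{\!\{a,b\}\!\},c\}\!\}_R$. A double algebra with bracket $\{\!\{\cdot,\cdot\}\!\}$ is a Lie double algebra if for all $a,b,c$: $\{\!\{a,b\}\!\}=-\{\!\{b,a\}\!\}^{(12)}$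 and $\{\!\{a,\{\!\{b,c\}\!\}\}\!\}_L-\{\!\{b,\{\!\{a,c\}\!\}\}\!\}_R^{(12)}=\{\!\{\{\!\{a,b\}\!\},c\}\!\}_L$ (in the claim, this is applied to the bracket $[\![\cdot,\cdot]\!]$). *)

theory Defs
  imports Complex_Main "HOL-Library.Poly_Mapping" "HOL-Combinatorics.Permutations"
begin

(* The free vector space on a set of words: finitely supported functions. *)

definition fscale :: "'k::field \<Rightarrow> ('a \<Rightarrow>\<^sub>0 'k) \<Rightarrow> ('a \<Rightarrow>\<^sub>0 'k)" where
  "fscale c p = Poly_Mapping.map ((*) c) p"

lemma lookup_fscale [simp]: "Poly_Mapping.lookup (fscale c p) w = c * Poly_Mapping.lookup p w"
  by (simp add: fscale_def Poly_Mapping.map.rep_eq when_def)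

global_interpretation free: vector_space fscale
  by standard (auto intro!: poly_mapping_eqI simp: lookup_add algebra_simps)

definition word :: "'a \<Rightarrow> 'a \<Rightarrow>\<^sub>0 'k::field" where
  "word w = Poly_Mapping.single w 1"

definition concat_mult :: "('a list \<Rightarrow>\<^sub>0 'k::field) \<Rightarrow> ('a list \<Rightarrow>\<^sub>0 'k) \<Rightarrow> ('a list \<Rightarrow>\<^sub>0 'k)" where
  "concat_mult p q = (\<Sum>u\<in>Poly_Mapping.keys p. \<Sum>w\<in>Poly_Mapping.keys q.
     fscale (Poly_Mapping.lookup p u * Poly_Mapping.lookup q w) (word (u @ w)))"

(* Tensors over V are cosets in the free vector space on words over V, modulo the relations
   saying that a word is linear in each of its letters.  The classes of combinations of words of
   length n form the n-th tensor power of V, and concatenation induces the product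
   V^(m) x V^(n) -> V^(m+n) of tensor powers.  Since the scalar multiplication is a locale
   parameter, tensors cannot be made a type of their own, so the carriers are explicit. *)

type_synonym ('v, 'k) tensor = "('v list \<Rightarrow>\<^sub>0 'k) set"

locale tensor_powers = vector_space scale
  for scale :: "'k::field \<Rightarrow> 'v::ab_group_add \<Rightarrow> 'v"
begin

definition multilinear_rels :: "('v list \<Rightarrow>\<^sub>0 'k) set" where
  "multilinear_rels =
     {word (xs @ (a + b) # ys) - word (xs @ a # ys) - word (xs @ b # ys) | xs a b ys. True} \<union>
     {word (xs @ scale c a # ys) - fscale c (word (xs @ a # ys)) | xs c a ys. True}"

definition tcls :: "('v list \<Rightarrow>\<^sub>0 'k) \<Rightarrow> ('v, 'k) tensor" where
  "tcls p = {q. q - p \<in> free.span multilinear_rels}"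

definition trep :: "('v, 'k) tensor \<Rightarrow> ('v list \<Rightarrow>\<^sub>0 'k)" where
  "trep X = (SOME p. p \<in> X)"

definition tpower :: "nat \<Rightarrow> ('v, 'k) tensor set" where
  "tpower n = tcls ` {p. \<forall>w\<in>Poly_Mapping.keys p. length w = n}"

definition tplus :: "('v, 'k) tensor \<Rightarrow> ('v, 'k) tensor \<Rightarrow> ('v, 'k) tensor" (infixl \<open>\<oplus>\<close> 65) where
  "X \<oplus> Y = tcls (trep X + trep Y)"

definition tminus :: "('v, 'k) tensor \<Rightarrow> ('v, 'k) tensor \<Rightarrow> ('v, 'k) tensor" (infixl \<open>\<ominus>\<close> 65) where
  "X \<ominus> Y = tcls (trep X - trep Y)"

definition tscale :: "'k \<Rightarrow> ('v, 'k) tensor \<Rightarrow> ('v, 'k) tensor" (infixr \<open>\<odot>\<close> 75) where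
  "c \<odot> X = tcls (fscale c (trep X))"

definition tmult :: "('v, 'k) tensor \<Rightarrow> ('v, 'k) tensor \<Rightarrow> ('v, 'k) tensor" (infixl \<open>\<otimes>\<close> 70) where
  "X \<otimes> Y = tcls (concat_mult (trep X) (trep Y))"

(* pure [v1, ..., vn] is the tensor v1 \<otimes> ... \<otimes> vn *)
definition pure :: "'v list \<Rightarrow> ('v, 'k) tensor" where
  "pure w = tcls (word w)"

definition tensor_linear :: "nat \<Rightarrow> nat \<Rightarrow> (('v, 'k) tensor \<Rightarrow> ('v, 'k) tensor) \<Rightarrow> bool" where
  "tensor_linear m n F \<longleftrightarrow>
     (\<forall>X\<in>tpower m. F X \<in> tpower n) \<and>
     (\<forall>X\<in>tpower m. \<forall>Y\<in>tpower m. F (X \<oplus> Y) = F X \<oplus> F Y) \<and>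
     (\<forall>c. \<forall>X\<in>tpower m. F (c \<odot> X) = c \<odot> F X)"

(* The linear map from the m-th to the n-th tensor power with prescribed values on pure tensors;
   it is unique on the m-th tensor power, outside of which its values are irrelevant. *)
definition lin_ext :: "nat \<Rightarrow> nat \<Rightarrow> ('v list \<Rightarrow> ('v, 'k) tensor) \<Rightarrow> ('v, 'k) tensor \<Rightarrow> ('v, 'k) tensor" where
  "lin_ext m n f = (SOME F. tensor_linear m n F \<and> (\<forall>w. length w = m \<longrightarrow> F (pure w) = f w))"

definition tperm :: "nat \<Rightarrow> (nat \<Rightarrow> nat) \<Rightarrow> ('v, 'k) tensor \<Rightarrow> ('v, 'k) tensor" where
  "tperm n \<sigma> = lin_ext n n (\<lambda>w. pure (permute_list \<sigma> w))"

(* Tensor factors are numbered from 0, so (12) and (23) are the transpositions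
   of 0, 1 and of 1, 2. *)
abbreviation swap12 :: "nat \<Rightarrow> ('v, 'k) tensor \<Rightarrow> ('v, 'k) tensor" where
  "swap12 n \<equiv> tperm n (Transposition.transpose 0 1)"

abbreviation swap23 :: "nat \<Rightarrow> ('v, 'k) tensor \<Rightarrow> ('v, 'k) tensor" where
  "swap23 n \<equiv> tperm n (Transposition.transpose 1 2)"

(* br a b is the value at a \<otimes> b of a linear map on the tensor square, the double bracket. *)
definition double_algebra :: "('v \<Rightarrow> 'v \<Rightarrow> ('v, 'k) tensor) \<Rightarrow> bool" where
  "double_algebra br \<longleftrightarrow> (\<exists>D. tensor_linear 2 2 D \<and> (\<forall>a b. br a b = D (pure [a, b])))"

definition ext3 :: "('v \<Rightarrow> 'v \<Rightarrow> 'v \<Rightarrow> ('v, 'k) tensor) \<Rightarrow> ('v, 'k) tensor \<Rightarrow> ('v, 'k) tensor" where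
  "ext3 f = lin_ext 3 3 (\<lambda>w. f (w ! 0) (w ! 1) (w ! 2))"

(* The four extensions of the bracket.  In the first two the second argument u is in the tensor
   square; in the last two it is the first argument. *)

definition outerL :: "('v \<Rightarrow> 'v \<Rightarrow> ('v, 'k) tensor) \<Rightarrow> 'v \<Rightarrow> ('v, 'k) tensor \<Rightarrow> ('v, 'k) tensor" where
  "outerL br a u = ext3 (\<lambda>x y z. br x y \<otimes> pure [z]) (pure [a] \<otimes> u)"

definition outerR :: "('v \<Rightarrow> 'v \<Rightarrow> ('v, 'k) tensor) \<Rightarrow> 'v \<Rightarrow> ('v, 'k) tensor \<Rightarrow> ('v, 'k) tensor" where
  "outerR br a u = ext3 (\<lambda>x y z. swap12 3 (pure [y] \<otimes> br x z)) (pure [a] \<otimes> u)"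

definition innerL :: "('v \<Rightarrow> 'v \<Rightarrow> ('v, 'k) tensor) \<Rightarrow> ('v, 'k) tensor \<Rightarrow> 'v \<Rightarrow> ('v, 'k) tensor" where
  "innerL br u c = ext3 (\<lambda>x y z. swap23 3 (br x z \<otimes> pure [y])) (u \<otimes> pure [c])"

definition innerR :: "('v \<Rightarrow> 'v \<Rightarrow> ('v, 'k) tensor) \<Rightarrow> ('v, 'k) tensor \<Rightarrow> 'v \<Rightarrow> ('v, 'k) tensor" where
  "innerR br u c = ext3 (\<lambda>x y z. pure [x] \<otimes> br y z) (u \<otimes> pure [c])"

definition assoc_double_algebra :: "('v \<Rightarrow> 'v \<Rightarrow> ('v, 'k) tensor) \<Rightarrow> bool" where
  "assoc_double_algebra br \<longleftrightarrow> double_algebra br \<and>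
     (\<forall>a b c. outerL br a (br b c) = innerL br (br a b) c) \<and>
     (\<forall>a b c. outerR br a (br b c) = innerR br (br a b) c)"

definition lie_double_algebra :: "('v \<Rightarrow> 'v \<Rightarrow> ('v, 'k) tensor) \<Rightarrow> bool" where
  "lie_double_algebra br \<longleftrightarrow> double_algebra br \<and>
     (\<forall>a b. br a b = (-1) \<odot> swap12 2 (br b a)) \<and>
     (\<forall>a b c. outerL br a (br b c) \<ominus> swap12 3 (outerR br b (br a c)) = innerL br (br a b) c)"

definition commutator :: "('v \<Rightarrow> 'v \<Rightarrow> ('v, 'k) tensor) \<Rightarrow> 'v \<Rightarrow> 'v \<Rightarrow> ('v, 'k) tensor" where
  "commutator br a b = br a b \<ominus> swap12 2 (br b a)"

end

end

(* Let P swap the factors of the tensor square, and let {a,b}^o = P{b,a},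
   so that the commutator is the difference of the two brackets.  Each extension of
   {.,.}^o, and each extension of {.,.} applied to P u, is a permutation of an extension of {.,.}
   applied to u.  Writing L(a,b,c) and R(a,b,c) for the two sides of the two associativity laws,
   s = (12) and t = (23), the terms of the Jacobi identity become
     {a,{b,c}}_L terms:       L(a,b,c) - t R(a,c,b) - st L(b,c,a) + sts R(c,b,a),
     {b,{a,c}}_R^(12) terms:  s R(b,a,c) - st L(b,c,a) - t R(a,c,b) + ts L(c,a,b),
     {{a,b},c}_L terms:       L(a,b,c) - s R(b,a,c) - ts L(c,a,b) + tst R(c,b,a),
   and the identity reduces to the braid relation sts = tst. *)

theory Submission
  imports Defs
begin

section \<open>Linear extension from a basis to the free vector space on it\<close>

definition fext :: "('a \<Rightarrow> ('b \<Rightarrow>\<^sub>0 'k)) \<Rightarrow> ('a \<Rightarrow>\<^sub>0 'k::field) \<Rightarrow> ('b \<Rightarrow>\<^sub>0 'k)" where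
  "fext g p = (\<Sum>w\<in>Poly_Mapping.keys p. fscale (Poly_Mapping.lookup p w) (g w))"

text \<open>The supports of \<open>p\<close>, \<open>q\<close> and \<open>p + q\<close> differ, and
  scaling by 0 empties a support. Summing over a common finite superset allows a comparison term by
  term.\<close>

lemma fext_superset:
  assumes "finite A" "Poly_Mapping.keys p \<subseteq> A"
  shows "fext g p = (\<Sum>w\<in>A. fscale (Poly_Mapping.lookup p w) (g w))"
  unfolding fext_def using assms
  by (intro sum.mono_neutral_left) (auto simp: in_keys_iff)

lemma fext_add: "fext g (p + q) = fext g p + fext g q"
proof -
  let ?A = "Poly_Mapping.keys p \<union> Poly_Mapping.keys q"
  have "fext g r = (\<Sum>w\<in>?A. fscale (Poly_Mapping.lookup r w) (g w))" if "r \<in> {p, q, p + q}" for r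
    using that Poly_Mapping.keys_add[of p q] by (intro fext_superset) auto
  then show ?thesis
    by (simp add: lookup_add free.scale_left_distrib sum.distrib)
qed

lemma fext_scale: "fext g (fscale c p) = fscale c (fext g p)"
proof -
  have "fext g (fscale c p)
      = (\<Sum>w\<in>Poly_Mapping.keys p. fscale (Poly_Mapping.lookup (fscale c p) w) (g w))"
    by (rule fext_superset) (auto simp: in_keys_iff)
  then show ?thesis
    by (simp add: fext_def free.scale_sum_right)
qed

lemma fext_diff: "fext g (p - q) = fext g p - fext g q"
  using fext_add[of g "p - q" q] by (simp add: algebra_simps)

lemma fext_word [simp]: "fext g (word w) = g w"
  by (simp add: fext_def word_def)

lemma fext_add_fun: "fext (\<lambda>w. g w + h w) p = fext g p + fext h p"
  by (simp add: fext_def free.scale_right_distrib sum.distrib)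

lemma fext_scale_fun: "fext (\<lambda>w. fscale c (g w)) p = fscale c (fext g p)"
  by (simp add: fext_def free.scale_sum_right mult.commute)

lemma fext_diff_fun: "fext (\<lambda>w. g w - h w) p = fext g p - fext h p"
  using fext_add_fun[of "\<lambda>w. g w - h w" h p] by (simp add: algebra_simps)

text \<open>Expands an element into its words; \<open>tpower_induct\<close> uses this to decompose a
  tensor into pure ones.\<close>

lemma fext_word_fun: "fext word p = p"
proof (rule poly_mapping_eqI)
  fix w
  have "Poly_Mapping.lookup (fext word p) w
      = (\<Sum>v\<in>Poly_Mapping.keys p. if w = v then Poly_Mapping.lookup p v else 0)"
    unfolding fext_def lookup_sum
    by (rule sum.cong[OF refl]) (auto simp: word_def lookup_single)
  also have "\<dots> = Poly_Mapping.lookup p w"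
    by (simp add: in_keys_iff)
  finally show "Poly_Mapping.lookup (fext word p) w = Poly_Mapping.lookup p w" .
qed

lemma fext_mem_subspace:
  assumes "free.subspace S" "\<And>w. w \<in> Poly_Mapping.keys p \<Longrightarrow> g w \<in> S"
  shows "fext g p \<in> S"
  unfolding fext_def using assms
  by (intro free.subspace_sum free.subspace_scale) auto

text \<open>The preimage of a span under a linear map is a subspace, so only generators have to be
  tested. Applied to the multilinear relations, this shows that a map descends to tensors.\<close>

lemma fext_mem_span:
  assumes "p \<in> free.span S" and "\<And>r. r \<in> S \<Longrightarrow> fext g r \<in> free.span T"
  shows "fext g p \<in> free.span T"
  using assms(1)
proof (rule free.span_induct)
  show "free.subspace {x. fext g x \<in> free.span T}"
    by (auto simp: free.subspace_def fext_add fext_scale free.span_add free.span_scale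
        fext_def[of g 0] free.span_zero)
qed (use assms(2) in auto)

lemma concat_mult_fext: "concat_mult p q = fext (\<lambda>u. fext (\<lambda>w. word (u @ w)) q) p"
  by (simp add: concat_mult_def fext_def free.scale_sum_right)

text \<open>With the left factor in the inner sum, fixing a word of the right factor leaves a linear
  function of \<open>p\<close>; the form above does the same for \<open>q\<close>.
  \<open>concat_mult_span\<close> needs both.\<close>

lemma concat_mult_fext2: "concat_mult p q = fext (\<lambda>w. fext (\<lambda>u. word (u @ w)) p) q"
  by (simp add: concat_mult_def fext_def free.scale_sum_right mult.commute
      sum.swap[of _ "Poly_Mapping.keys p"])

text \<open>\<open>permute_list \<sigma>\<close> reads entry \<open>\<sigma> j\<close> at place
  \<open>j\<close>, so a change at \<open>i\<close> shows up where \<open>\<sigma> j = i\<close>.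
  This makes permuting the factors multilinear.\<close>

lemma permute_list_update:
  assumes "\<sigma> permutes {..<n}" "length w = n" "i < n"
  shows "permute_list \<sigma> (w[i := a]) = (permute_list \<sigma> w)[inv \<sigma> i := a]"
proof (rule nth_equalityI)
  fix j assume "j < length (permute_list \<sigma> (w[i := a]))"
  then have j: "j < n" using assms by simp
  then have "\<sigma> j < n" using assms(1) by (metis lessThan_iff permutes_in_image)
  moreover have "inv \<sigma> i = j \<longleftrightarrow> i = \<sigma> j"
    using assms(1) by (metis permutes_inverses)
  ultimately show "permute_list \<sigma> (w[i := a]) ! j = (permute_list \<sigma> w)[inv \<sigma> i := a] ! j"
    using j assms by (auto simp: permute_list_nth nth_list_update)
qed simp

context tensor_powers
begin

section \<open>Tensors as classes modulo the multilinear relations\<close>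

lemma tcls_eq_iff: "tcls p = tcls q \<longleftrightarrow> p - q \<in> free.span multilinear_rels"
proof
  assume "tcls p = tcls q"
  moreover have "p \<in> tcls p" by (simp add: tcls_def free.span_zero)
  ultimately show "p - q \<in> free.span multilinear_rels" by (simp add: tcls_def)
next
  assume *: "p - q \<in> free.span multilinear_rels"
  have "r - p \<in> free.span multilinear_rels \<longleftrightarrow> r - q \<in> free.span multilinear_rels" for r
    using free.span_add_eq[OF *, of "r - p"] by (simp add: algebra_simps)
  then show "tcls p = tcls q" by (simp add: tcls_def)
qed

lemma trep_tcls: "trep (tcls p) - p \<in> free.span multilinear_rels"
proof -
  have "p \<in> tcls p" by (simp add: tcls_def free.span_zero)
  then have "trep (tcls p) \<in> tcls p" unfolding trep_def by (rule someI)
  then show ?thesis by (simp add: tcls_def)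
qed

lemma tcls_trep: "X \<in> range tcls \<Longrightarrow> tcls (trep X) = X"
  by (metis imageE tcls_eq_iff trep_tcls)

text \<open>\<open>trep\<close> picks a representative that differs from the given one by an element
  of the relation span, and spans are closed under sums. As simp rules, this lemma and its analogues
  for \<ominus>, \<odot> and \<otimes> reduce identities between tensors to identities in the free
  vector space.\<close>

lemma tcls_plus [simp]: "tcls p \<oplus> tcls q = tcls (p + q)"
  using free.span_add[OF trep_tcls[of p] trep_tcls[of q]]
  by (simp add: tplus_def tcls_eq_iff algebra_simps)

lemma tcls_minus [simp]: "tcls p \<ominus> tcls q = tcls (p - q)"
  using free.span_diff[OF trep_tcls[of p] trep_tcls[of q]]
  by (simp add: tminus_def tcls_eq_iff algebra_simps)

lemma tcls_scale [simp]: "c \<odot> tcls p = tcls (fscale c p)"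
  using free.span_scale[OF trep_tcls[of p], of c]
  by (simp add: tscale_def tcls_eq_iff free.scale_right_diff_distrib)

lemma multilinear_relsE [consumes 1, case_names add scale]:
  assumes "r \<in> multilinear_rels"
  obtains xs a b ys where "r = word (xs @ (a + b) # ys) - word (xs @ a # ys) - word (xs @ b # ys)"
  | xs c a ys where "r = word (xs @ scale c a # ys) - fscale c (word (xs @ a # ys))"
  using assms unfolding multilinear_rels_def by blast

text \<open>Concatenating a fixed word only lengthens the context \<open>xs\<close> or
  \<open>ys\<close> of a relation, which yields a relation of the same kind.\<close>

lemma concat_word_rels:
  assumes "r \<in> multilinear_rels"
  shows "fext (\<lambda>w. word (u @ w)) r \<in> free.span multilinear_rels"
    and "fext (\<lambda>w. word (w @ u)) r \<in> free.span multilinear_rels"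
proof -
  from assms have "fext (\<lambda>w. word (u @ w)) r \<in> multilinear_rels \<and>
             fext (\<lambda>w. word (w @ u)) r \<in> multilinear_rels"
  proof (cases rule: multilinear_relsE)
    case (add xs a b ys)
    have "word ((u @ xs) @ (a + b) # ys) - word ((u @ xs) @ a # ys) - word ((u @ xs) @ b # ys)
            \<in> multilinear_rels"
      "word (xs @ (a + b) # (ys @ u)) - word (xs @ a # (ys @ u)) - word (xs @ b # (ys @ u))
            \<in> multilinear_rels"
      unfolding multilinear_rels_def by blast+
    with add show ?thesis by (simp add: fext_diff)
  next
    case (scale xs c a ys)
    have "word ((u @ xs) @ scale c a # ys) - fscale c (word ((u @ xs) @ a # ys))
            \<in> multilinear_rels"
      "word (xs @ scale c a # (ys @ u)) - fscale c (word (xs @ a # (ys @ u)))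
            \<in> multilinear_rels"
      unfolding multilinear_rels_def by blast+
    with scale show ?thesis by (simp add: fext_diff fext_scale)
  qed
  then show "fext (\<lambda>w. word (u @ w)) r \<in> free.span multilinear_rels"
    and "fext (\<lambda>w. word (w @ u)) r \<in> free.span multilinear_rels"
    by (auto intro: free.span_base)
qed

text \<open>The element of the span is put into the inner sum, where each word of the other factor
  acts by concatenation and \<open>concat_word_rels\<close> applies. So the span is a two-sided
  ideal, and \<otimes> is well defined on classes.\<close>

lemma concat_mult_span:
  assumes "p \<in> free.span multilinear_rels"
  shows "concat_mult p q \<in> free.span multilinear_rels"
    and "concat_mult q p \<in> free.span multilinear_rels"
  unfolding concat_mult_fext2[of p] concat_mult_fext[of q]
  by (intro fext_mem_subspace free.subspace_span fext_mem_span[OF assms] concat_word_rels; assumption)+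

lemma concat_mult_add:
  "concat_mult (p + p') q = concat_mult p q + concat_mult p' q"
  "concat_mult p (q + q') = concat_mult p q + concat_mult p q'"
  by (simp_all add: concat_mult_fext fext_add fext_add_fun)

lemma concat_mult_diff:
  "concat_mult (p - p') q = concat_mult p q - concat_mult p' q"
  "concat_mult p (q - q') = concat_mult p q - concat_mult p q'"
  by (simp_all add: concat_mult_fext fext_diff fext_diff_fun)

lemma concat_mult_scale:
  "concat_mult (fscale c p) q = fscale c (concat_mult p q)"
  "concat_mult p (fscale c q) = fscale c (concat_mult p q)"
  by (simp_all add: concat_mult_fext fext_scale fext_scale_fun)

lemma tcls_mult [simp]: "tcls p \<otimes> tcls q = tcls (concat_mult p q)"
proof -
  let ?p = "trep (tcls p)" and ?q = "trep (tcls q)"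
  \<comment> \<open>Replacing the representatives one factor at a time leaves two products that lie
    in the ideal.\<close>
  have "concat_mult ?p ?q - concat_mult p q = concat_mult (?p - p) ?q + concat_mult p (?q - q)"
    by (simp add: concat_mult_diff)
  also have "\<dots> \<in> free.span multilinear_rels"
    by (intro free.span_add concat_mult_span trep_tcls)
  finally show ?thesis by (simp add: tmult_def tcls_eq_iff)
qed

lemma pure_mult [simp]: "pure u \<otimes> pure v = pure (u @ v)"
  by (simp add: pure_def concat_mult_fext)

lemma pure_add: "pure (xs @ (a + b) # ys) = pure (xs @ a # ys) \<oplus> pure (xs @ b # ys)"
proof -
  have "word (xs @ (a + b) # ys) - word (xs @ a # ys) - word (xs @ b # ys) \<in> multilinear_rels"
    unfolding multilinear_rels_def by blast
  from free.span_base[OF this] show ?thesis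
    by (simp add: pure_def tcls_eq_iff algebra_simps)
qed

lemma pure_scale: "pure (xs @ scale c a # ys) = c \<odot> pure (xs @ a # ys)"
proof -
  have "word (xs @ scale c a # ys) - fscale c (word (xs @ a # ys)) \<in> multilinear_rels"
    unfolding multilinear_rels_def by blast
  from free.span_base[OF this] show ?thesis
    by (simp add: pure_def tcls_eq_iff)
qed

lemma pure_update:
  assumes "i < length w"
  shows "pure (w[i := a + b]) = pure (w[i := a]) \<oplus> pure (w[i := b])"
    and "pure (w[i := scale c a]) = c \<odot> pure (w[i := a])"
  using assms by (simp_all add: upd_conv_take_nth_drop pure_add pure_scale)

lemma pure_singleton_add: "pure [a + b] = pure [a] \<oplus> pure [b]"
  using pure_add[of "[]" a b "[]"] by simp

lemma pure_singleton_scale: "pure [scale c a] = c \<odot> pure [a]"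
  using pure_scale[of "[]" c a "[]"] by simp

section \<open>Tensor powers and induction over their elements\<close>

lemma tpowerE:
  assumes "X \<in> tpower n"
  obtains p where "X = tcls p" "\<forall>w\<in>Poly_Mapping.keys p. length w = n"
  using assms by (auto simp: tpower_def)

lemma tpowerI: "\<forall>w\<in>Poly_Mapping.keys p. length w = n \<Longrightarrow> tcls p \<in> tpower n"
  by (auto simp: tpower_def)

lemma tpower_range: "X \<in> tpower n \<Longrightarrow> X \<in> range tcls"
  by (auto simp: tpower_def)

lemma pure_range [simp]: "pure w \<in> range tcls"
  by (simp add: pure_def)

lemma tpower_pure [simp]: "length w = n \<Longrightarrow> pure w \<in> tpower n"
  unfolding pure_def by (intro tpowerI) (simp add: word_def)

lemma tpower_add: "X \<in> tpower n \<Longrightarrow> Y \<in> tpower n \<Longrightarrow> X \<oplus> Y \<in> tpower n"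
  by (elim tpowerE) (auto intro!: tpowerI dest!: set_mp[OF Poly_Mapping.keys_add])

lemma tpower_scale: "X \<in> tpower n \<Longrightarrow> c \<odot> X \<in> tpower n"
  by (elim tpowerE) (auto intro!: tpowerI simp: in_keys_iff)

lemma tminus_conv: "X \<in> range tcls \<Longrightarrow> Y \<in> range tcls \<Longrightarrow> X \<ominus> Y = X \<oplus> (-1) \<odot> Y"
  by auto

lemma tpower_minus: "X \<in> tpower n \<Longrightarrow> Y \<in> tpower n \<Longrightarrow> X \<ominus> Y \<in> tpower n"
  by (simp add: tminus_conv tpower_range tpower_add tpower_scale)

lemma tpower_zero: "tcls 0 \<in> tpower n"
  by (rule tpowerI) simp

text \<open>A representative supported on words of length \<open>n\<close> is a finite combination
  of them, so pure tensors span \<open>tpower n\<close>. The zero case is the empty sum.\<close>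

lemma tpower_induct [consumes 1, case_names zero pure add scale]:
  assumes X: "X \<in> tpower n"
    and zero: "P (tcls 0)"
    and pure: "\<And>w. length w = n \<Longrightarrow> P (pure w)"
    and add: "\<And>X Y. X \<in> tpower n \<Longrightarrow> Y \<in> tpower n \<Longrightarrow> P X \<Longrightarrow> P Y \<Longrightarrow> P (X \<oplus> Y)"
    and scale: "\<And>c X. X \<in> tpower n \<Longrightarrow> P X \<Longrightarrow> P (c \<odot> X)"
  shows "P X"
proof -
  from X obtain p where p: "X = tcls p" "\<forall>w\<in>Poly_Mapping.keys p. length w = n"
    by (rule tpowerE)
  have "tcls (\<Sum>w\<in>A. fscale (Poly_Mapping.lookup p w) (word w)) \<in> tpower n \<and>
        P (tcls (\<Sum>w\<in>A. fscale (Poly_Mapping.lookup p w) (word w)))"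
    if "finite A" "A \<subseteq> Poly_Mapping.keys p" for A
    using that
  proof (induction A)
    case empty
    then show ?case by (simp add: zero tpower_zero)
  next
    case (insert w A)
    then have w: "length w = n" using p by auto
    have "tcls (\<Sum>w\<in>insert w A. fscale (Poly_Mapping.lookup p w) (word w))
        = Poly_Mapping.lookup p w \<odot> pure w
            \<oplus> tcls (\<Sum>w\<in>A. fscale (Poly_Mapping.lookup p w) (word w))"
      using insert by (simp add: pure_def)
    then show ?case using insert w
      by (auto intro!: tpower_add tpower_scale add scale pure)
  qed
  from this[of "Poly_Mapping.keys p"] show ?thesis
    using fext_word_fun[of p] by (simp add: p fext_def)
qed

lemma tmult_add:
  assumes "X \<in> range tcls" "Y \<in> range tcls" "Z \<in> range tcls"
  shows "(X \<oplus> Y) \<otimes> Z = X \<otimes> Z \<oplus> Y \<otimes> Z" "Z \<otimes> (X \<oplus> Y) = Z \<otimes> X \<oplus> Z \<otimes> Y"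
  using assms by (auto simp: concat_mult_add)

lemma tmult_scale:
  assumes "X \<in> range tcls" "Y \<in> range tcls"
  shows "(c \<odot> X) \<otimes> Y = c \<odot> (X \<otimes> Y)" "X \<otimes> (c \<odot> Y) = c \<odot> (X \<otimes> Y)"
  using assms by (auto simp: concat_mult_scale)

text \<open>Bilinearity reduces the claim to pure tensors, first on the left and then on the right;
  there the lengths add up.\<close>

lemma tpower_mult:
  assumes "X \<in> tpower m" "Y \<in> tpower n"
  shows "X \<otimes> Y \<in> tpower (m + n)"
  using assms(1)
proof (induction X rule: tpower_induct)
  case zero
  from assms(2) obtain q where "Y = tcls q" by (rule tpowerE)
  then show ?case by (simp add: concat_mult_fext fext_def[of _ 0] tpower_zero)
next
  case (pure u)
  with assms(2) show ?case
  proof (induction Y rule: tpower_induct)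
    case zero
    then show ?case
      by (simp add: tensor_powers.pure_def[OF tensor_powers_axioms] concat_mult_fext2
          fext_def[of _ 0] tpower_zero)
  qed (simp_all add: tmult_add tmult_scale tpower_range tpower_add tpower_scale)
qed (use assms(2) in \<open>simp_all add: tmult_add tmult_scale tpower_range tpower_add tpower_scale\<close>)

section \<open>Linear maps between tensor powers\<close>

lemma tensor_linear_mem: "tensor_linear m n F \<Longrightarrow> X \<in> tpower m \<Longrightarrow> F X \<in> tpower n"
  by (simp add: tensor_linear_def)

lemma tensor_linear_add:
  "tensor_linear m n F \<Longrightarrow> X \<in> tpower m \<Longrightarrow> Y \<in> tpower m \<Longrightarrow> F (X \<oplus> Y) = F X \<oplus> F Y"
  by (simp add: tensor_linear_def)

lemma tensor_linear_scale:
  "tensor_linear m n F \<Longrightarrow> X \<in> tpower m \<Longrightarrow> F (c \<odot> X) = c \<odot> F X"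
  by (simp add: tensor_linear_def)

lemma tensor_linear_minus:
  assumes F: "tensor_linear m n F" and "X \<in> tpower m" "Y \<in> tpower m"
  shows "F (X \<ominus> Y) = F X \<ominus> F Y"
proof -
  have "F X \<in> range tcls" "F Y \<in> range tcls"
    using assms tensor_linear_mem tpower_range by blast+
  then show ?thesis using assms
    by (simp add: tminus_conv tpower_range tensor_linear_add[OF F] tensor_linear_scale[OF F]
        tpower_scale)
qed

text \<open>Pure tensors span the tensor power. Identities between swaps and between bracket
  extensions are checked on pure tensors through this lemma, in its versions for two and three
  factors.\<close>

lemma tensor_linear_eqI:
  assumes F: "tensor_linear m n F" and G: "tensor_linear m n G"
    and eq: "\<And>w. length w = m \<Longrightarrow> F (pure w) = G (pure w)"
    and X: "X \<in> tpower m"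
  shows "F X = G X"
  using X
proof (induction rule: tpower_induct)
  case zero
  \<comment> \<open>\<open>tensor_linear\<close> has no clause for zero. Writing zero as a multiple
    by the scalar 0 turns both values into \<open>tcls 0\<close>.\<close>
  have "tcls 0 = 0 \<odot> tcls 0" by simp
  also have "F \<dots> = G \<dots>"
    using tensor_linear_mem[OF F tpower_zero] tensor_linear_mem[OF G tpower_zero]
    by (simp only: tensor_linear_scale[OF F tpower_zero] tensor_linear_scale[OF G tpower_zero])
       (auto elim!: tpowerE)
  finally show ?case .
qed (simp_all add: eq tensor_linear_add[OF F] tensor_linear_add[OF G]
    tensor_linear_scale[OF F] tensor_linear_scale[OF G])

section \<open>Multilinear maps and the universal property of tensor powers\<close>

definition tensor_multilinear :: "nat \<Rightarrow> nat \<Rightarrow> ('v list \<Rightarrow> ('v, 'k) tensor) \<Rightarrow> bool" where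
  "tensor_multilinear m n f \<longleftrightarrow>
     (\<forall>w. length w = m \<longrightarrow> f w \<in> tpower n) \<and>
     (\<forall>w i a b. length w = m \<longrightarrow> i < m \<longrightarrow> f (w[i := a + b]) = f (w[i := a]) \<oplus> f (w[i := b])) \<and>
     (\<forall>w i c a. length w = m \<longrightarrow> i < m \<longrightarrow> f (w[i := scale c a]) = c \<odot> f (w[i := a]))"

lemma tensor_multilinear_mem:
  "tensor_multilinear m n f \<Longrightarrow> length w = m \<Longrightarrow> f w \<in> tpower n"
  unfolding tensor_multilinear_def by blast

lemma tensor_multilinear_add:
  "tensor_multilinear m n f \<Longrightarrow> length w = m \<Longrightarrow> i < m
    \<Longrightarrow> f (w[i := a + b]) = f (w[i := a]) \<oplus> f (w[i := b])"
  unfolding tensor_multilinear_def by blast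

lemma tensor_multilinear_scale:
  "tensor_multilinear m n f \<Longrightarrow> length w = m \<Longrightarrow> i < m
    \<Longrightarrow> f (w[i := scale c a]) = c \<odot> f (w[i := a])"
  unfolding tensor_multilinear_def by blast

text \<open>This is the universal property: the linear extension of \<open>f\<close> to the free
  vector space sends relations into the relation span, hence induces a map of classes. Since
  \<open>lin_ext\<close> is a \<open>SOME\<close> choice, its properties rest on the existence of
  this map.\<close>

lemma lin_ext:
  assumes f: "tensor_multilinear m n f"
  shows "tensor_linear m n (lin_ext m n f)"
    and "length w = m \<Longrightarrow> lin_ext m n f (pure w) = f w"
proof -
  \<comment> \<open>All words in one relation have the same length. The value 0 on lengths other
    than \<open>m\<close> sends the relations between such words to 0, and \<open>f\<close> is
    evaluated only where multilinearity is assumed.\<close>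
  define g where "g w = (if length w = m then trep (f w) else 0)" for w
  define F where "F X = tcls (fext g (trep X))" for X
  have mem: "f w \<in> tpower n" if "length w = m" for w
    using tensor_multilinear_mem[OF f that] .
  have tr: "tcls (trep (f w)) = f w" if "length w = m" for w
    by (rule tcls_trep[OF tpower_range[OF mem[OF that]]])
  have rels: "fext g r \<in> free.span multilinear_rels" if "r \<in> multilinear_rels" for r
    using that
  proof (cases rule: multilinear_relsE)
    case r: (add xs a b ys)
    show ?thesis
    proof (cases "length (xs @ a # ys) = m")
      case True
      \<comment> \<open>The slot in which the relation is linear has index
        \<open>length xs\<close>.\<close>
      note tensor_multilinear_add[OF f this, of "length xs" a b]
      then have "tcls (trep (f (xs @ (a + b) # ys)))
          = tcls (trep (f (xs @ a # ys))) \<oplus> tcls (trep (f (xs @ b # ys)))"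
        using True by (subst (1 2 3) tr) simp_all
      then show ?thesis using True
        by (simp add: r g_def fext_diff fext_add tcls_eq_iff algebra_simps)
    next
      case False
      then show ?thesis by (simp add: r g_def fext_diff free.span_zero)
    qed
  next
    case r: (scale xs c a ys)
    show ?thesis
    proof (cases "length (xs @ a # ys) = m")
      case True
      note tensor_multilinear_scale[OF f this, of "length xs" c a]
      then have "tcls (trep (f (xs @ scale c a # ys))) = c \<odot> tcls (trep (f (xs @ a # ys)))"
        using True by (subst (1 2) tr) simp_all
      then show ?thesis using True
        by (simp add: r g_def fext_diff fext_scale tcls_eq_iff)
    next
      case False
      then show ?thesis by (simp add: r g_def fext_diff fext_scale free.span_zero)
    qed
  qed
  \<comment> \<open>By \<open>rels\<close>, the difference of two representatives is mapped into the
    span, so \<open>F\<close> can be computed from any representative.\<close>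
  have F: "F (tcls p) = tcls (fext g p)" for p
    using fext_mem_span[OF trep_tcls rels, of p] by (simp add: F_def tcls_eq_iff fext_diff)
  have Fpure: "F (pure w) = f w" if "length w = m" for w
    using that by (simp add: pure_def F g_def tr)
  have Fadd: "F (X \<oplus> Y) = F X \<oplus> F Y" if "X \<in> tpower m" "Y \<in> tpower m" for X Y
    using that by (auto elim!: tpowerE simp: F fext_add)
  have Fscale: "F (c \<odot> X) = c \<odot> F X" if "X \<in> tpower m" for c X
    using that by (auto elim!: tpowerE simp: F fext_scale)
  have Fmem: "F X \<in> tpower n" if "X \<in> tpower m" for X
    using that
    by (induction rule: tpower_induct)
      (auto simp: F fext_def[of _ 0] Fpure Fadd Fscale mem tpower_zero tpower_add tpower_scale)
  have "tensor_linear m n F \<and> (\<forall>w. length w = m \<longrightarrow> F (pure w) = f w)"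
    using Fpure Fadd Fscale Fmem by (simp add: tensor_linear_def)
  then have *: "tensor_linear m n (lin_ext m n f) \<and>
      (\<forall>w. length w = m \<longrightarrow> lin_ext m n f (pure w) = f w)"
    unfolding lin_ext_def
    by (rule someI[where P = "\<lambda>F. tensor_linear m n F \<and>
          (\<forall>w. length w = m \<longrightarrow> F (pure w) = f w)"])
  then show "tensor_linear m n (lin_ext m n f)"
    and "length w = m \<Longrightarrow> lin_ext m n f (pure w) = f w" by simp_all
qed

section \<open>Permutations of tensor factors\<close>

lemma tensor_multilinear_permute:
  assumes "\<sigma> permutes {..<n}"
  shows "tensor_multilinear n n (\<lambda>w. pure (permute_list \<sigma> w))"
proof -
  have pos: "inv \<sigma> i < n" if "i < n" for i
    using that permutes_in_image[OF permutes_inv[OF assms]] by fastforce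
  show ?thesis
    using assms pos
    by (simp add: tensor_multilinear_def permute_list_update pure_update)
qed

lemma tperm_pure:
  "\<sigma> permutes {..<n} \<Longrightarrow> length w = n \<Longrightarrow> tperm n \<sigma> (pure w) = pure (permute_list \<sigma> w)"
  unfolding tperm_def by (simp add: lin_ext tensor_multilinear_permute)

lemma tensor_linear_tperm: "\<sigma> permutes {..<n} \<Longrightarrow> tensor_linear n n (tperm n \<sigma>)"
  unfolding tperm_def by (simp add: lin_ext tensor_multilinear_permute)

lemma transposition_permutes:
  "Transposition.transpose 0 1 permutes {..<2::nat}"
  "Transposition.transpose 0 1 permutes {..<3::nat}"
  "Transposition.transpose 1 2 permutes {..<3::nat}"
  by (auto intro!: permutes_swap_id)

lemma swap_pure [simp]:
  "swap12 2 (pure [x, y]) = pure [y, x]"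
  "swap12 3 (pure [x, y, z]) = pure [y, x, z]"
  "swap23 3 (pure [x, y, z]) = pure [x, z, y]"
  using transposition_permutes
  by (simp_all add: tperm_pure permute_list_def Transposition.transpose_def)

text \<open>The swaps contain the number \<open>1\<close> in their transpositions; rewriting it to
  \<open>Suc 0\<close> would keep the simp rules for swaps from matching.\<close>

declare One_nat_def [simp del]

section \<open>Closure properties of linear maps, and identities between swaps\<close>

lemma tensor_linear_id: "tensor_linear n n (\<lambda>X. X)"
  by (simp add: tensor_linear_def)

lemma tensor_linear_comp:
  assumes "tensor_linear m n F" "tensor_linear k m G"
  shows "tensor_linear k n (\<lambda>X. F (G X))"
  using assms by (simp add: tensor_linear_def)

text \<open>The degree \<open>k\<close> is a variable with an equation so that a numeral such as 3
  can be supplied for \<open>n + length w\<close>.\<close>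

lemma tensor_linear_mult:
  assumes F: "tensor_linear m n F" and k: "k = n + length w"
  shows "tensor_linear m k (\<lambda>X. F X \<otimes> pure w)" "tensor_linear m k (\<lambda>X. pure w \<otimes> F X)"
proof -
  have r: "F X \<in> range tcls" if "X \<in> tpower m" for X
    using tensor_linear_mem[OF F that] by (rule tpower_range)
  show "tensor_linear m k (\<lambda>X. F X \<otimes> pure w)"
    using tpower_mult[OF tensor_linear_mem[OF F] tpower_pure[OF refl, of w]] r k
    by (simp add: tensor_linear_def tmult_add tmult_scale tensor_linear_add[OF F]
        tensor_linear_scale[OF F])
  show "tensor_linear m k (\<lambda>X. pure w \<otimes> F X)"
    using tpower_mult[OF tpower_pure[OF refl, of w] tensor_linear_mem[OF F]] r k
    by (simp add: tensor_linear_def tmult_add tmult_scale tensor_linear_add[OF F]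
        tensor_linear_scale[OF F] add.commute)
qed

lemma tminus_add_distrib:
  assumes "X \<in> range tcls" "Y \<in> range tcls" "X' \<in> range tcls" "Y' \<in> range tcls"
  shows "(X \<oplus> X') \<ominus> (Y \<oplus> Y') = (X \<ominus> Y) \<oplus> (X' \<ominus> Y')"
  using assms by (auto simp: algebra_simps)

lemma tminus_scale_distrib:
  assumes "X \<in> range tcls" "Y \<in> range tcls"
  shows "c \<odot> X \<ominus> c \<odot> Y = c \<odot> (X \<ominus> Y)"
  using assms by (auto simp: free.scale_right_diff_distrib)

lemma tensor_linear_tminus:
  assumes "tensor_linear m n F" "tensor_linear m n G"
  shows "tensor_linear m n (\<lambda>X. F X \<ominus> G X)"
  using assms
  by (simp add: tensor_linear_def tpower_minus tpower_range[of _ n] tminus_add_distrib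
      tminus_scale_distrib)

lemma tensor_linear_swap:
  "tensor_linear 2 2 (swap12 2)" "tensor_linear 3 3 (swap12 3)" "tensor_linear 3 3 (swap23 3)"
  using transposition_permutes by (simp_all add: tensor_linear_tperm)

lemmas tensor_linear_swap_comp = tensor_linear_swap[THEN tensor_linear_comp]

lemma length_2_conv: "length w = 2 \<longleftrightarrow> (\<exists>x y. w = [x, y])"
  by (auto simp: numeral_2_eq_2 length_Suc_conv)

lemma length_3_conv: "length w = 3 \<longleftrightarrow> (\<exists>x y z. w = [x, y, z])"
  by (auto simp: numeral_3_eq_3 length_Suc_conv)

lemma tensor_linear_eqI2:
  assumes "tensor_linear 2 n F" "tensor_linear 2 n G"
    and "\<And>x y. F (pure [x, y]) = G (pure [x, y])" "X \<in> tpower 2"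
  shows "F X = G X"
  by (rule tensor_linear_eqI[OF assms(1,2) _ assms(4)]) (auto simp: length_2_conv assms(3))

lemma tensor_linear_eqI3:
  assumes "tensor_linear 3 n F" "tensor_linear 3 n G"
    and "\<And>x y z. F (pure [x, y, z]) = G (pure [x, y, z])" "X \<in> tpower 3"
  shows "F X = G X"
  by (rule tensor_linear_eqI[OF assms(1,2) _ assms(4)]) (auto simp: length_3_conv assms(3))

lemma swap_swap:
  "X \<in> tpower 2 \<Longrightarrow> swap12 2 (swap12 2 X) = X"
  "Y \<in> tpower 3 \<Longrightarrow> swap12 3 (swap12 3 Y) = Y"
  "Y \<in> tpower 3 \<Longrightarrow> swap23 3 (swap23 3 Y) = Y"
proof -
  note lin = tensor_linear_swap_comp tensor_linear_id
  show "X \<in> tpower 2 \<Longrightarrow> swap12 2 (swap12 2 X) = X"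
    by (rule tensor_linear_eqI2, (rule lin)+, simp_all)
  show "Y \<in> tpower 3 \<Longrightarrow> swap12 3 (swap12 3 Y) = Y"
    by (rule tensor_linear_eqI3, (rule lin)+, simp_all)
  show "Y \<in> tpower 3 \<Longrightarrow> swap23 3 (swap23 3 Y) = Y"
    by (rule tensor_linear_eqI3, (rule lin)+, simp_all)
qed

text \<open>On a pure tensor both sides reverse the order of the three factors.\<close>

lemma swap_braid:
  assumes "X \<in> tpower 3"
  shows "swap12 3 (swap23 3 (swap12 3 X)) = swap23 3 (swap12 3 (swap23 3 X))"
  by (rule tensor_linear_eqI3[OF _ _ _ assms], (rule tensor_linear_swap_comp tensor_linear_id)+, simp)

text \<open>The first two swaps touch only the factors that come from \<open>X\<close>; the
  composite in the third carries \<open>y\<close> past both of them.\<close>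

lemma swap_mult_pure:
  assumes "X \<in> tpower 2"
  shows "swap12 3 (X \<otimes> pure [y]) = swap12 2 X \<otimes> pure [y]"
    and "swap23 3 (pure [y] \<otimes> X) = pure [y] \<otimes> swap12 2 X"
    and "swap23 3 (swap12 3 (pure [y] \<otimes> X)) = X \<otimes> pure [y]"
proof -
  have mult: "tensor_linear k 3 (\<lambda>X. F X \<otimes> pure [z])" "tensor_linear k 3 (\<lambda>X. pure [z] \<otimes> F X)"
    if "tensor_linear k 2 F" for k F z
    using tensor_linear_mult[OF that, of 3 "[z]"] by simp_all
  note lin = tensor_linear_swap_comp mult tensor_linear_id
  show "swap12 3 (X \<otimes> pure [y]) = swap12 2 X \<otimes> pure [y]"
    by (rule tensor_linear_eqI2[OF _ _ _ assms], (rule lin)+, simp)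
  show "swap23 3 (pure [y] \<otimes> X) = pure [y] \<otimes> swap12 2 X"
    by (rule tensor_linear_eqI2[OF _ _ _ assms], (rule lin)+, simp)
  show "swap23 3 (swap12 3 (pure [y] \<otimes> X)) = X \<otimes> pure [y]"
    by (rule tensor_linear_eqI2[OF _ _ _ assms], (rule lin)+, simp)
qed

section \<open>Double brackets as bilinear maps\<close>

definition tensor_bilinear :: "('v \<Rightarrow> 'v \<Rightarrow> ('v, 'k) tensor) \<Rightarrow> bool" where
  "tensor_bilinear br \<longleftrightarrow>
     (\<forall>a b. br a b \<in> tpower 2) \<and>
     (\<forall>a b c. br (a + b) c = br a c \<oplus> br b c) \<and>
     (\<forall>a b c. br a (b + c) = br a b \<oplus> br a c) \<and>
     (\<forall>r a b. br (scale r a) b = r \<odot> br a b) \<and>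
     (\<forall>r a b. br a (scale r b) = r \<odot> br a b)"

lemma less_3_cases: "i < 3 \<Longrightarrow> i = 0 \<or> i = 1 \<or> i = (2::nat)"
  by auto

text \<open>The universal property for two factors supplies the linear map on the tensor square.
  Bilinearity passes directly to swaps and differences, so it is the form used for the
  commutator.\<close>

lemma double_algebra_iff: "double_algebra br \<longleftrightarrow> tensor_bilinear br"
proof
  assume "double_algebra br"
  then obtain D where D: "tensor_linear 2 2 D" and br: "\<And>a b. br a b = D (pure [a, b])"
    by (auto simp: double_algebra_def)
  have "pure [a + b, c] = pure [a, c] \<oplus> pure [b, c]" "pure [a, b + c] = pure [a, b] \<oplus> pure [a, c]"
    "pure [scale r a, b] = r \<odot> pure [a, b]" "pure [a, scale r b] = r \<odot> pure [a, b]" for a b c r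
    using pure_add[of "[]" a b "[c]"] pure_add[of "[a]" b c "[]"]
      pure_scale[of "[]" r a "[b]"] pure_scale[of "[a]" r b "[]"] by simp_all
  then show "tensor_bilinear br"
    by (simp add: tensor_bilinear_def br tensor_linear_mem[OF D] tensor_linear_add[OF D]
        tensor_linear_scale[OF D])
next
  assume br: "tensor_bilinear br"
  let ?f = "\<lambda>w. br (w ! 0) (w ! 1)"
  have "tensor_multilinear 2 2 ?f"
    using br by (auto simp: tensor_multilinear_def tensor_bilinear_def length_2_conv less_2_cases_iff)
  then have "tensor_linear 2 2 (lin_ext 2 2 ?f)" "\<And>a b. br a b = lin_ext 2 2 ?f (pure [a, b])"
    by (simp_all add: lin_ext)
  then show "double_algebra br"
    unfolding double_algebra_def by blast
qed

lemma tensor_bilinear_mem: "tensor_bilinear br \<Longrightarrow> br a b \<in> tpower 2"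
  by (simp add: tensor_bilinear_def)

lemma tensor_bilinear_swap:
  assumes "tensor_bilinear br"
  shows "tensor_bilinear (\<lambda>a b. swap12 2 (br b a))"
  using assms
  by (simp add: tensor_bilinear_def tensor_linear_mem[OF tensor_linear_swap(1)]
      tensor_linear_add[OF tensor_linear_swap(1)] tensor_linear_scale[OF tensor_linear_swap(1)])

lemma tensor_bilinear_tminus:
  assumes "tensor_bilinear f" "tensor_bilinear g"
  shows "tensor_bilinear (\<lambda>a b. f a b \<ominus> g a b)"
  using assms
  by (simp add: tensor_bilinear_def tpower_minus tpower_range[of _ 2] tminus_add_distrib
      tminus_scale_distrib)

lemma tensor_bilinear_commutator:
  "tensor_bilinear br \<Longrightarrow> tensor_bilinear (commutator br)"
  using tensor_bilinear_tminus[OF _ tensor_bilinear_swap] by (simp add: commutator_def[abs_def])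

section \<open>The four extensions of a bracket\<close>

definition tensor_trilinear :: "('v \<Rightarrow> 'v \<Rightarrow> 'v \<Rightarrow> ('v, 'k) tensor) \<Rightarrow> bool" where
  "tensor_trilinear f \<longleftrightarrow>
     (\<forall>x y z. f x y z \<in> tpower 3) \<and>
     (\<forall>x x' y z. f (x + x') y z = f x y z \<oplus> f x' y z) \<and>
     (\<forall>x y y' z. f x (y + y') z = f x y z \<oplus> f x y' z) \<and>
     (\<forall>x y z z'. f x y (z + z') = f x y z \<oplus> f x y z') \<and>
     (\<forall>r x y z. f (scale r x) y z = r \<odot> f x y z) \<and>
     (\<forall>r x y z. f x (scale r y) z = r \<odot> f x y z) \<and>
     (\<forall>r x y z. f x y (scale r z) = r \<odot> f x y z)"

text \<open>Trilinearity is the case of three factors in the universal property; it guarantees that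
  the map chosen in \<open>ext3\<close> has the prescribed values.\<close>

lemma ext3:
  assumes "tensor_trilinear f"
  shows "tensor_linear 3 3 (ext3 f)" "ext3 f (pure [x, y, z]) = f x y z"
proof -
  have "tensor_multilinear 3 3 (\<lambda>w. f (w ! 0) (w ! 1) (w ! 2))"
    using assms
    by (auto simp: tensor_multilinear_def tensor_trilinear_def length_3_conv One_nat_def dest!: less_3_cases)
  from lin_ext[OF this] show "tensor_linear 3 3 (ext3 f)" "ext3 f (pure [x, y, z]) = f x y z"
    by (simp_all add: ext3_def)
qed

lemma tensor_trilinear_mult:
  assumes "tensor_bilinear br"
  shows "tensor_trilinear (\<lambda>x y z. br x y \<otimes> pure [z])"
    and "tensor_trilinear (\<lambda>x y z. pure [x] \<otimes> br y z)"
    and "tensor_trilinear (\<lambda>x y z. swap12 3 (pure [y] \<otimes> br x z))"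
    and "tensor_trilinear (\<lambda>x y z. swap23 3 (br x z \<otimes> pure [y]))"
proof -
  note lin = tensor_linear_mult[OF tensor_linear_id, of 3 2 "[x]" for x, simplified]
  have [simp]: "br x y \<in> range tcls" for x y
    by (rule tpower_range[OF tensor_bilinear_mem[OF assms]])
  have [simp]: "br x y \<otimes> pure [z] \<in> tpower 3" "pure [z] \<otimes> br x y \<in> tpower 3" for x y z
    using assms lin[THEN tensor_linear_mem] by (auto simp: tensor_bilinear_def)
  note simps = tensor_trilinear_def tmult_add tmult_scale pure_singleton_add pure_singleton_scale
    tensor_linear_swap[THEN tensor_linear_mem] tensor_linear_swap[THEN tensor_linear_add]
    tensor_linear_swap[THEN tensor_linear_scale]
  show "tensor_trilinear (\<lambda>x y z. br x y \<otimes> pure [z])"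
    using assms by (simp add: simps tensor_bilinear_def)
  show "tensor_trilinear (\<lambda>x y z. pure [x] \<otimes> br y z)"
    using assms by (simp add: simps tensor_bilinear_def)
  show "tensor_trilinear (\<lambda>x y z. swap12 3 (pure [y] \<otimes> br x z))"
    using assms by (simp add: simps tensor_bilinear_def)
  show "tensor_trilinear (\<lambda>x y z. swap23 3 (br x z \<otimes> pure [y]))"
    using assms by (simp add: simps tensor_bilinear_def)
qed

lemma bracket_ext_pure:
  assumes "tensor_bilinear br"
  shows "outerL br a (pure [x, y]) = br a x \<otimes> pure [y]"
    and "outerR br a (pure [x, y]) = swap12 3 (pure [x] \<otimes> br a y)"
    and "innerL br (pure [x, y]) c = swap23 3 (br x c \<otimes> pure [y])"
    and "innerR br (pure [x, y]) c = pure [x] \<otimes> br y c"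
  by (simp_all add: outerL_def outerR_def innerL_def innerR_def
      ext3 tensor_trilinear_mult[OF assms])

lemma bracket_ext_linear:
  assumes "tensor_bilinear br"
  shows "tensor_linear 2 3 (outerL br a)" "tensor_linear 2 3 (outerR br a)"
    and "tensor_linear 2 3 (\<lambda>u. innerL br u c)" "tensor_linear 2 3 (\<lambda>u. innerR br u c)"
  unfolding outerL_def[abs_def] outerR_def[abs_def] innerL_def innerR_def
  by ((rule tensor_linear_comp[OF ext3(1)] tensor_trilinear_mult assms
      tensor_linear_mult tensor_linear_id)+, simp)+

text \<open>Both sides are linear in \<open>u\<close>, and on a pure tensor they place the same
  bracket into the same slots. Passing to the opposite bracket trades outer for inner extensions,
  because it exchanges the arguments; swapping the factors of \<open>u\<close> trades L for
  R.\<close>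

lemma bracket_ext_swap:
  assumes br: "tensor_bilinear br" and u: "u \<in> tpower 2"
  shows "outerL (\<lambda>a b. swap12 2 (br b a)) a u = swap12 3 (swap23 3 (innerL br u a))"
    and "outerR (\<lambda>a b. swap12 2 (br b a)) a u = swap12 3 (swap23 3 (innerR br u a))"
    and "innerL (\<lambda>a b. swap12 2 (br b a)) u a = swap23 3 (swap12 3 (outerL br a u))"
    and "outerL br a (swap12 2 u) = swap23 3 (outerR br a u)"
    and "innerL br (swap12 2 u) a = swap12 3 (innerR br u a)"
proof -
  note brs = tensor_bilinear_swap[OF br]
  note [simp] = tensor_bilinear_mem[OF br] bracket_ext_pure[OF br] bracket_ext_pure[OF brs]
    swap_mult_pure swap_swap tensor_linear_mem[OF tensor_linear_swap(1)]
  have [simp]: "br x y \<otimes> pure [z] \<in> tpower 3" "pure [z] \<otimes> br x y \<in> tpower 3" for x y z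
    using tpower_mult[of "br x y" 2 "pure [z]" 1] tpower_mult[of "pure [z]" 1 "br x y" 2] by simp_all
  note lin = bracket_ext_linear[OF br] bracket_ext_linear[OF brs] tensor_linear_swap_comp
    bracket_ext_linear[OF br, THEN tensor_linear_comp, OF tensor_linear_swap(1)]
  show "outerL (\<lambda>a b. swap12 2 (br b a)) a u = swap12 3 (swap23 3 (innerL br u a))"
    by (rule tensor_linear_eqI2[OF _ _ _ u]) ((rule lin)+, simp)
  show "outerR (\<lambda>a b. swap12 2 (br b a)) a u = swap12 3 (swap23 3 (innerR br u a))"
    by (rule tensor_linear_eqI2[OF _ _ _ u]) ((rule lin)+, simp)
  show "innerL (\<lambda>a b. swap12 2 (br b a)) u a = swap23 3 (swap12 3 (outerL br a u))"
    by (rule tensor_linear_eqI2[OF _ _ _ u]) ((rule lin)+, simp)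
  show "outerL br a (swap12 2 u) = swap23 3 (outerR br a u)"
    by (rule tensor_linear_eqI2[OF _ _ _ u]) ((rule lin)+, simp)
  \<comment> \<open>This is \<open>swap_mult_pure(3)\<close> read backwards; the forward rule is
    removed below because the two together would loop.\<close>
  have *: "br x a \<otimes> pure [y] = swap23 3 (swap12 3 (pure [y] \<otimes> br x a))" for x y
    by simp
  show "innerL br (swap12 2 u) a = swap12 3 (innerR br u a)"
    by (rule tensor_linear_eqI2[OF _ _ _ u])
      ((rule lin)+, simp add: * tensor_linear_mem[OF tensor_linear_swap(2)] del: swap_mult_pure(3))
qed

text \<open>Products with a pure tensor and swaps are linear, so on pure tensors each extension
  depends linearly on the bracket. This splits the outer bracket of a nested commutator.\<close>

lemma bracket_ext_tminus:
  assumes f: "tensor_bilinear f" and g: "tensor_bilinear g" and u: "u \<in> tpower 2"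
  shows "outerL (\<lambda>a b. f a b \<ominus> g a b) a u = outerL f a u \<ominus> outerL g a u"
    and "outerR (\<lambda>a b. f a b \<ominus> g a b) a u = outerR f a u \<ominus> outerR g a u"
    and "innerL (\<lambda>a b. f a b \<ominus> g a b) u c = innerL f u c \<ominus> innerL g u c"
proof -
  note fg = tensor_bilinear_tminus[OF f g]
  note lin = bracket_ext_linear[OF f] bracket_ext_linear[OF g] bracket_ext_linear[OF fg]
    tensor_linear_tminus
  note [simp] = bracket_ext_pure[OF f] bracket_ext_pure[OF g] bracket_ext_pure[OF fg]
    tensor_bilinear_mem[OF f] tensor_bilinear_mem[OF g]
  have mult: "tensor_linear 2 3 (\<lambda>X. X \<otimes> pure [y])" "tensor_linear 2 3 (\<lambda>X. pure [y] \<otimes> X)" for y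
    by (rule tensor_linear_mult[OF tensor_linear_id]; simp)+
  note [simp] = mult[THEN tensor_linear_minus] mult[THEN tensor_linear_mem]
    tensor_linear_swap[THEN tensor_linear_minus]
  show "outerL (\<lambda>a b. f a b \<ominus> g a b) a u = outerL f a u \<ominus> outerL g a u"
    by (rule tensor_linear_eqI2[OF _ _ _ u]) ((rule lin)+, simp)
  show "outerR (\<lambda>a b. f a b \<ominus> g a b) a u = outerR f a u \<ominus> outerR g a u"
    by (rule tensor_linear_eqI2[OF _ _ _ u]) ((rule lin)+, simp)
  show "innerL (\<lambda>a b. f a b \<ominus> g a b) u c = innerL f u c \<ominus> innerL g u c"
    by (rule tensor_linear_eqI2[OF _ _ _ u]) ((rule lin)+, simp)
qed

section \<open>Skew-symmetry and the Jacobi identity for the commutator\<close>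

lemma commutator_skew:
  assumes "tensor_bilinear br"
  shows "commutator br a b = (-1) \<odot> swap12 2 (commutator br b a)"
proof -
  have mem: "br a b \<in> tpower 2" "swap12 2 (br b a) \<in> tpower 2"
    "br b a \<in> tpower 2" "swap12 2 (br a b) \<in> tpower 2"
    using assms by (simp_all add: tensor_bilinear_def tensor_linear_mem[OF tensor_linear_swap(1)])
  \<comment> \<open>The swap is an involution, so the subtracted term comes back as
    \<open>br a b\<close> itself.\<close>
  have "swap12 2 (commutator br b a) = swap12 2 (br b a) \<ominus> br a b"
    using mem by (simp add: commutator_def tensor_linear_minus[OF tensor_linear_swap(1)] swap_swap)
  moreover have "br a b \<ominus> swap12 2 (br b a) = (-1) \<odot> (swap12 2 (br b a) \<ominus> br a b)"
    using mem by (auto elim!: tpowerE)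
  ultimately show ?thesis by (simp add: commutator_def)
qed

lemma commutator_jacobi:
  assumes "assoc_double_algebra br"
  shows "outerL (commutator br) a (commutator br b c)
           \<ominus> swap12 3 (outerR (commutator br) b (commutator br a c))
         = innerL (commutator br) (commutator br a b) c"
proof -
  have br: "tensor_bilinear br"
    and assocL: "\<And>a b c. innerL br (br a b) c = outerL br a (br b c)"
    and assocR: "\<And>a b c. innerR br (br a b) c = outerR br a (br b c)"
    using assms by (simp_all add: assoc_double_algebra_def double_algebra_iff)
  \<comment> \<open>Associativity is oriented from inner to outer extensions in
    \<open>assocL\<close> and \<open>assocR\<close>, so that all twelve terms become permutations of
    values of \<open>L\<close> and \<open>R\<close>.\<close>
  define L where "L a b c = outerL br a (br b c)" for a b c
  define R where "R a b c = outerR br a (br b c)" for a b c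
  let ?s1 = "swap12 3" and ?s2 = "swap23 3"
  have mem [simp]: "L x y z \<in> tpower 3" "R x y z \<in> tpower 3" "br x y \<in> tpower 2" for x y z
    using bracket_ext_linear[OF br, THEN tensor_linear_mem] tensor_bilinear_mem[OF br]
    by (simp_all add: L_def R_def)
  note swap_mem [simp] = tensor_linear_swap[THEN tensor_linear_mem]
  \<comment> \<open>In this form \<open>bracket_ext_tminus\<close> applies, with the opposite
    bracket as the second one.\<close>
  have comm: "commutator br = (\<lambda>a b. br a b \<ominus> swap12 2 (br b a))"
    by (simp add: commutator_def[abs_def])
  \<comment> \<open>The rule for \<open>outerL\<close> is applied to the swapped \<open>u\<close>,
    and the involutions on both sides are then cancelled.\<close>
  have outerR_swap: "outerR br x (swap12 2 u) = ?s2 (outerL br x u)" if "u \<in> tpower 2" for x u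
    using bracket_ext_swap(4)[OF br swap_mem(1)[OF that], of x] that
      bracket_ext_linear(2)[OF br, THEN tensor_linear_mem, OF swap_mem(1)[OF that], of x]
    by (simp add: swap_swap)
  have innerR_swap: "innerR br (swap12 2 u) x = ?s1 (innerL br u x)" if "u \<in> tpower 2" for x u
    using bracket_ext_swap(5)[OF br swap_mem(1)[OF that], of x] that
      bracket_ext_linear(4)[OF br, THEN tensor_linear_mem, OF swap_mem(1)[OF that], of x]
    by (simp add: swap_swap)
  note ext_minus = bracket_ext_linear[OF br, THEN tensor_linear_minus]
  note rules = bracket_ext_tminus[OF br tensor_bilinear_swap[OF br]] bracket_ext_swap[OF br]
    ext_minus outerR_swap innerR_swap assocL assocR L_def[symmetric] R_def[symmetric]
    tensor_linear_swap[THEN tensor_linear_minus] swap_swap tpower_minus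
  have 1: "outerL (commutator br) a (commutator br b c)
      = (L a b c \<ominus> ?s2 (R a c b)) \<ominus> (?s1 (?s2 (L b c a)) \<ominus> ?s1 (?s2 (?s1 (R c b a))))"
    by (simp add: comm rules)
  have 2: "?s1 (outerR (commutator br) b (commutator br a c))
      = (?s1 (R b a c) \<ominus> ?s1 (?s2 (L b c a))) \<ominus> (?s2 (R a c b) \<ominus> ?s2 (?s1 (L c a b)))"
    by (simp add: comm rules)
  have 3: "innerL (commutator br) (commutator br a b) c
      = (L a b c \<ominus> ?s1 (R b a c)) \<ominus> (?s2 (?s1 (L c a b)) \<ominus> ?s2 (?s1 (?s2 (R c b a))))"
    by (simp add: comm rules)
  \<comment> \<open>Here \<open>B\<close> and \<open>C\<close> stand for the terms in
    \<open>R a c b\<close> and \<open>L b c a\<close>, which occur in both expansions on the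
    left-hand side.\<close>
  have cancel: "((A \<ominus> B) \<ominus> (C \<ominus> D)) \<ominus> ((E \<ominus> C) \<ominus> (B \<ominus> F)) = (A \<ominus> E) \<ominus> (F \<ominus> D)"
    if "A \<in> range tcls" "B \<in> range tcls" "C \<in> range tcls" "D \<in> range tcls"
      "E \<in> range tcls" "F \<in> range tcls" for A B C D E F
    using that by (auto simp: algebra_simps)
  \<comment> \<open>The braid relation gives the \<open>R c b a\<close> term of the first expansion
    the form that it has in the third.\<close>
  show ?thesis
    unfolding 1 2 3 swap_braid[OF mem(2)]
    by (rule cancel) (rule tpower_range[of _ 3], simp)+
qed

end

theorem lemma1:
  fixes scale :: "'k::field \<Rightarrow> 'v::ab_group_add \<Rightarrow> 'v"
    and br :: "'v \<Rightarrow> 'v \<Rightarrow> ('v, 'k) tensor"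
  assumes "vector_space scale"
    and "tensor_powers.assoc_double_algebra scale br"
  shows "tensor_powers.lie_double_algebra scale (tensor_powers.commutator scale br)"
proof -
  interpret tensor_powers scale
    using assms(1) by (simp add: tensor_powers_def)
  have "tensor_bilinear br"
    using assms(2) by (simp add: assoc_double_algebra_def double_algebra_iff)
  then show ?thesis
    unfolding lie_double_algebra_def double_algebra_iff
    by (intro conjI allI tensor_bilinear_commutator commutator_skew commutator_jacobi[OF assms(2)])
qed

end
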